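(* Let $Q=(U,\Omega,r)$ be a non-degenerate multimatroid, let $A$ be a subtransversal of $\Omega$, and let $e\in A$ satisfy $r(\{e\})=1$. Then there is an independent set $I$ of $Q$ such that $e\in I$ and $Q|A=Q|I$.
   Context: A multimatroid $Q=(U,\Omega,r)$ consists of a finite set $U$, a partition $\Omega$ of $U$ into sets called skew classes (two distinct elements of the same skew class form a skew pair), and a function $r:\mathcal S(\Omega)\to\mathbb Z_{\ge 0}$ on the set $\mathcal S(\Omega)$ of subtransversals (sets meeting each skew class in at most one element; a transversal meets each skew class in exactly one element) satisfying: (1) $r(\emptyset)=0$; (2) $r(A)\le r(A\cup x)\le r(A)+1$ whenever $A\in\mathcal S(\Omega)$ and $x$ lies in a skew class avoiding $A$; (3) $r(A)+r(B)\ge r(A\cup B)+r(A\cap B)$ whenever $A\cup B\in\mathcal S(\Omega)$; (4) $r(A\cup x)-r(A)+r(A\cup y)-r(A)\ge 1$ whenever $A\in\mathcal S(\Omega)$ and $\{x,y\}$ is a skew pair in a skew class avoiding $A$. $Q$ is non-degenerate if no skew class has size $1$. A subtransversal $S$ is independent if $r(S)=|S|$. For $A\in\mathcal S(\Omega)$, the minor $Q|A$ is the multimatroid $(U',\Omega',r')$ where $\Omega'$ consists of the skew classes disjoint from $A$, $U'=\bigcup\Omega'$, and $r'(X)=r(X\cup A)-r(A)$ for subtransversals $X$ of $\Omega'$. Two multimatroids are equal if they have the same ground set, skew classes and rank function. *)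

theory Defs
  imports Main "HOL-Library.Disjoint_Sets"
begin

definition subtransversals :: "'a set set \<Rightarrow> 'a set set" where
  "subtransversals \<Omega> =
    {S. S \<subseteq> \<Union>\<Omega> \<and> (\<forall>\<omega>\<in>\<Omega>. \<forall>x\<in>S \<inter> \<omega>. \<forall>y\<in>S \<inter> \<omega>. x = y)}"

text \<open>The values of \<open>rank\<close> are meaningful only on subtransversals of the skew classes.\<close>

record 'a mm =
  ground :: "'a set"
  skew_classes :: "'a set set"
  rank :: "'a set \<Rightarrow> nat"

locale multimatroid =
  fixes Q :: "'a mm"
  assumes finite_ground: "finite (ground Q)"
    and partition: "partition_on (ground Q) (skew_classes Q)"
    and rank_empty: "rank Q {} = 0"
    and rank_insert:
      "\<lbrakk>A \<in> subtransversals (skew_classes Q); \<omega> \<in> skew_classes Q; A \<inter> \<omega> = {}; x \<in> \<omega>\<rbrakk>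
        \<Longrightarrow> rank Q A \<le> rank Q (insert x A) \<and> rank Q (insert x A) \<le> rank Q A + 1"
    and rank_submodular:
      "\<lbrakk>A \<in> subtransversals (skew_classes Q); B \<in> subtransversals (skew_classes Q);
        A \<union> B \<in> subtransversals (skew_classes Q)\<rbrakk>
        \<Longrightarrow> rank Q A + rank Q B \<ge> rank Q (A \<union> B) + rank Q (A \<inter> B)"
    and rank_skew_pair:
      "\<lbrakk>A \<in> subtransversals (skew_classes Q); \<omega> \<in> skew_classes Q; A \<inter> \<omega> = {};
        x \<in> \<omega>; y \<in> \<omega>; x \<noteq> y\<rbrakk>
        \<Longrightarrow> (int (rank Q (insert x A)) - int (rank Q A))
            + (int (rank Q (insert y A)) - int (rank Q A)) \<ge> 1"

definition non_degenerate :: "'a mm \<Rightarrow> bool" where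
  "non_degenerate Q \<longleftrightarrow> (\<forall>\<omega>\<in>skew_classes Q. card \<omega> \<noteq> 1)"

definition independent :: "'a mm \<Rightarrow> 'a set \<Rightarrow> bool" where
  "independent Q S \<longleftrightarrow> S \<in> subtransversals (skew_classes Q) \<and> rank Q S = card S"

text \<open>The subtraction of naturals does not truncate: see \<open>rank_mono\<close> and \<open>multimatroid_minor\<close> below.\<close>

definition minor :: "'a mm \<Rightarrow> 'a set \<Rightarrow> 'a mm" where
  "minor Q A =
    (let \<Omega>' = {\<omega> \<in> skew_classes Q. \<omega> \<inter> A = {}} in
      \<lparr>ground = \<Union>\<Omega>', skew_classes = \<Omega>', rank = (\<lambda>X. rank Q (X \<union> A) - rank Q A)\<rparr>)"

text \<open>Record equality would be too fine, since it also compares \<open>rank\<close> outside the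
  subtransversals.\<close>

definition mm_eq :: "'a mm \<Rightarrow> 'a mm \<Rightarrow> bool" where
  "mm_eq Q Q' \<longleftrightarrow> ground Q = ground Q' \<and> skew_classes Q = skew_classes Q' \<and>
    (\<forall>X\<in>subtransversals (skew_classes Q). rank Q X = rank Q' X)"

lemma subtransversals_mono:
  "B \<in> subtransversals \<Omega> \<Longrightarrow> A \<subseteq> B \<Longrightarrow> A \<in> subtransversals \<Omega>"
  unfolding subtransversals_def by blast

lemma subtransversals_unique:
  "S \<in> subtransversals \<Omega> \<Longrightarrow> \<omega> \<in> \<Omega> \<Longrightarrow> x \<in> S \<Longrightarrow> x \<in> \<omega> \<Longrightarrow> y \<in> S \<Longrightarrow> y \<in> \<omega> \<Longrightarrow> x = y"
  unfolding subtransversals_def by simp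

context multimatroid
begin

lemma rank_mono:
  assumes "A \<union> X \<in> subtransversals (skew_classes Q)"
  shows "rank Q A \<le> rank Q (X \<union> A)"
proof -
  have "X \<subseteq> ground Q"
    using assms partition unfolding subtransversals_def partition_on_def by blast
  then have "finite X"
    using finite_ground finite_subset by blast
  then show ?thesis
    using assms
  proof (induction X rule: finite_induct)
    case empty
    then show ?case by simp
  next
    case (insert x X)
    have S: "A \<union> X \<in> subtransversals (skew_classes Q)"
      using subtransversals_mono[OF insert.prems] by blast
    have le: "rank Q A \<le> rank Q (X \<union> A)"
      using insert.IH[OF S] .
    show ?case
    proof (cases "x \<in> A")
      case True
      then have "insert x X \<union> A = X \<union> A" by blast
      then show ?thesis using le by simp
    next
      case False
      obtain \<omega> where w: "\<omega> \<in> skew_classes Q" "x \<in> \<omega>"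
        using insert.prems unfolding subtransversals_def by blast
      have "(X \<union> A) \<inter> \<omega> = {}"
      proof (rule equals0I)
        fix y
        assume y: "y \<in> (X \<union> A) \<inter> \<omega>"
        then have "x = y"
          using subtransversals_unique[OF insert.prems w(1), of x y] w by blast
        then show False
          using y False insert.hyps by simp
      qed
      then have "rank Q (X \<union> A) \<le> rank Q (insert x (X \<union> A))"
        using rank_insert[of "X \<union> A" \<omega> x] S w by (simp add: Un_commute)
      then show ?thesis using le by simp
    qed
  qed
qed

end

lemma subtransversals_minor:
  assumes partition: "partition_on U \<Omega>"
    and A: "A \<in> subtransversals \<Omega>"
    and X: "X \<in> subtransversals {\<omega> \<in> \<Omega>. \<omega> \<inter> A = {}}"
  shows "X \<union> A \<in> subtransversals \<Omega>"
proof -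
  have "x = y" if "\<omega> \<in> \<Omega>" "x \<in> (X \<union> A) \<inter> \<omega>" "y \<in> (X \<union> A) \<inter> \<omega>" for \<omega> x y
  proof (cases "\<omega> \<inter> A = {}")
    case True
    then show ?thesis using X that unfolding subtransversals_def by blast
  next
    case False
    have disj: "\<omega> \<inter> \<omega>' = {}"
      if "\<omega>' \<in> \<Omega>" "\<omega>' \<inter> A = {}" for \<omega>'
      using partition that \<open>\<omega> \<in> \<Omega>\<close> False
      unfolding partition_on_def disjoint_def by (metis (no_types))
    have "X \<inter> \<omega> = {}"
      using X disj unfolding subtransversals_def by blast
    then show ?thesis using A that unfolding subtransversals_def by blast
  qed
  moreover have "A \<subseteq> \<Union>\<Omega>"
    using A unfolding subtransversals_def by simp
  moreover have "X \<subseteq> \<Union>\<Omega>"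
    using X unfolding subtransversals_def by auto
  ultimately show ?thesis unfolding subtransversals_def by simp
qed

lemma (in multimatroid) multimatroid_minor:
  assumes A: "A \<in> subtransversals (skew_classes Q)"
  shows "multimatroid (minor Q A)"
proof -
  define \<Omega> where "\<Omega> = {\<omega> \<in> skew_classes Q. \<omega> \<inter> A = {}}"
  have sel: "skew_classes (minor Q A) = \<Omega>" "ground (minor Q A) = \<Union>\<Omega>"
    "\<And>X. rank (minor Q A) X = rank Q (X \<union> A) - rank Q A"
    by (simp_all add: minor_def \<Omega>_def Let_def)
  have sub: "X \<union> A \<in> subtransversals (skew_classes Q)" if "X \<in> subtransversals \<Omega>" for X
    using subtransversals_minor[OF partition A] that unfolding \<Omega>_def by blast
  have mono: "rank Q A \<le> rank Q (X \<union> A)" if "X \<in> subtransversals \<Omega>" for X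
    using rank_mono[of A X] sub[OF that] by (simp add: Un_commute)
  have ins: "insert x X \<in> subtransversals \<Omega>"
    if X: "X \<in> subtransversals \<Omega>" and w: "\<omega> \<in> \<Omega>" and d: "X \<inter> \<omega> = {}" and x: "x \<in> \<omega>" for X \<omega> x
  proof -
    have "u = v" if "\<omega>' \<in> \<Omega>" "u \<in> insert x X \<inter> \<omega>'" "v \<in> insert x X \<inter> \<omega>'" for \<omega>' u v
    proof (cases "\<omega>' = \<omega>")
      case True
      then show ?thesis using that d by blast
    next
      case False
      then have "\<omega>' \<inter> \<omega> = {}"
        using partition that(1) w unfolding partition_on_def disjoint_def \<Omega>_def by simp
      then have "u \<in> X" "v \<in> X" using that x by auto
      then show ?thesis using subtransversals_unique[OF X that(1)] that by blast
    qed
    moreover have "insert x X \<subseteq> \<Union>\<Omega>"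
      using X w x unfolding subtransversals_def by auto
    ultimately show ?thesis unfolding subtransversals_def by simp
  qed
  have step: "rank Q (X \<union> A) \<le> rank Q (insert x X \<union> A)"
    "rank Q (insert x X \<union> A) \<le> rank Q (X \<union> A) + 1"
    if X: "X \<in> subtransversals \<Omega>" and w: "\<omega> \<in> \<Omega>" and d: "X \<inter> \<omega> = {}" and x: "x \<in> \<omega>" for X \<omega> x
  proof -
    have "\<omega> \<in> skew_classes Q" "(X \<union> A) \<inter> \<omega> = {}"
      using w d unfolding \<Omega>_def by auto
    then show "rank Q (X \<union> A) \<le> rank Q (insert x X \<union> A)"
      "rank Q (insert x X \<union> A) \<le> rank Q (X \<union> A) + 1"
      using rank_insert[OF sub[OF X], of \<omega> x] x by simp_all
  qed
  show ?thesis
  proof (unfold_locales, unfold sel)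
    have "\<Union>\<Omega> \<subseteq> ground Q"
      using partition unfolding partition_on_def \<Omega>_def by auto
    then show "finite (\<Union>\<Omega>)"
      using finite_ground finite_subset by blast
    show "partition_on (\<Union>\<Omega>) \<Omega>"
      using partition unfolding partition_on_def disjoint_def \<Omega>_def by simp
    show "rank Q ({} \<union> A) - rank Q A = 0"
      by simp
  next
    fix X \<omega> x
    assume h: "X \<in> subtransversals \<Omega>" "\<omega> \<in> \<Omega>" "X \<inter> \<omega> = {}" "x \<in> \<omega>"
    show "rank Q (X \<union> A) - rank Q A \<le> rank Q (insert x X \<union> A) - rank Q A \<and>
      rank Q (insert x X \<union> A) - rank Q A \<le> rank Q (X \<union> A) - rank Q A + 1"
      using step[OF h] mono[OF h(1)] by linarith
  next
    fix X Y
    assume h: "X \<in> subtransversals \<Omega>" "Y \<in> subtransversals \<Omega>" "X \<union> Y \<in> subtransversals \<Omega>"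
    have I: "X \<inter> Y \<in> subtransversals \<Omega>"
      using subtransversals_mono[OF h(1)] by blast
    have "(X \<union> A) \<union> (Y \<union> A) = (X \<union> Y) \<union> A" "(X \<union> A) \<inter> (Y \<union> A) = (X \<inter> Y) \<union> A"
      by auto
    then have "rank Q ((X \<union> Y) \<union> A) + rank Q ((X \<inter> Y) \<union> A) \<le> rank Q (X \<union> A) + rank Q (Y \<union> A)"
      using rank_submodular[OF sub[OF h(1)] sub[OF h(2)]] sub[OF h(3)] by simp
    then show "rank Q (X \<union> Y \<union> A) - rank Q A + (rank Q (X \<inter> Y \<union> A) - rank Q A)
      \<le> rank Q (X \<union> A) - rank Q A + (rank Q (Y \<union> A) - rank Q A)"
      using mono[OF h(1)] mono[OF h(2)] mono[OF h(3)] mono[OF I] by linarith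
  next
    fix X \<omega> x y
    assume h: "X \<in> subtransversals \<Omega>" "\<omega> \<in> \<Omega>" "X \<inter> \<omega> = {}" "x \<in> \<omega>" "y \<in> \<omega>" "x \<noteq> y"
    have "\<omega> \<in> skew_classes Q" "(X \<union> A) \<inter> \<omega> = {}"
      using h unfolding \<Omega>_def by auto
    then have "int (rank Q (insert x X \<union> A)) - int (rank Q (X \<union> A)) +
        (int (rank Q (insert y X \<union> A)) - int (rank Q (X \<union> A))) \<ge> 1"
      using rank_skew_pair[OF sub[OF h(1)], of \<omega> x y] h by simp
    then show "1 \<le> int (rank Q (insert x X \<union> A) - rank Q A) - int (rank Q (X \<union> A) - rank Q A) +
        (int (rank Q (insert y X \<union> A) - rank Q A) - int (rank Q (X \<union> A) - rank Q A))"
      using mono[OF h(1)] mono[OF ins[OF h(1-4)]] mono[OF ins[OF h(1-3,5)]] by linarith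
  qed
qed

end

theory Submission
  imports Defs
begin

text \<open>If \<open>x \<in> A\<close> satisfies \<open>r(A - x) = r(A)\<close>, then \<open>x\<close> is singular in \<open>Q|(A - x)\<close>, and replacing
  \<open>x\<close> by any other element of its skew class does not change the minor but raises the rank of
  \<open>A\<close> by one. If \<open>A\<close> is dependent and \<open>r({e}) = 1\<close>, such an \<open>x\<close> exists with \<open>x \<noteq> e\<close>, since otherwise
  adding the elements of \<open>A - e\<close> to \<open>{e}\<close> one by one would raise the rank at every step. So
  exchanges that keep \<open>e\<close> lead to an independent set.\<close>

context multimatroid
begin

lemma skew_classes_eqI:
  "\<omega> \<in> skew_classes Q \<Longrightarrow> \<omega>' \<in> skew_classes Q \<Longrightarrow> x \<in> \<omega> \<Longrightarrow> x \<in> \<omega>' \<Longrightarrow> \<omega> = \<omega>'"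
  using partition unfolding partition_on_def disjoint_def by blast

lemma finite_subtransversal:
  assumes "S \<in> subtransversals (skew_classes Q)"
  shows "finite S"
proof -
  have "S \<subseteq> ground Q"
    using assms partition unfolding subtransversals_def partition_on_def by blast
  then show ?thesis
    using finite_ground finite_subset by blast
qed

lemma subtransversal_insert:
  assumes S: "S \<in> subtransversals (skew_classes Q)"
    and w: "\<omega> \<in> skew_classes Q" "S \<inter> \<omega> = {}" "x \<in> \<omega>"
  shows "insert x S \<in> subtransversals (skew_classes Q)"
proof -
  have "u = v" if "\<omega>' \<in> skew_classes Q" "u \<in> insert x S \<inter> \<omega>'" "v \<in> insert x S \<inter> \<omega>'" for \<omega>' u v
  proof (cases "\<omega>' = \<omega>")
    case True
    then show ?thesis using that w by blast
  next
    case False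
    then have "x \<notin> \<omega>'"
      using skew_classes_eqI that(1) w by blast
    then show ?thesis
      using that subtransversals_unique[OF S that(1), of u v] by blast
  qed
  moreover have "insert x S \<subseteq> \<Union>(skew_classes Q)"
    using S w unfolding subtransversals_def by blast
  ultimately show ?thesis
    unfolding subtransversals_def by blast
qed

lemma subtransversal_skew_class:
  assumes "S \<in> subtransversals (skew_classes Q)" "x \<in> S"
  obtains \<omega> where "\<omega> \<in> skew_classes Q" "x \<in> \<omega>" "(S - {x}) \<inter> \<omega> = {}"
proof -
  obtain \<omega> where w: "\<omega> \<in> skew_classes Q" "x \<in> \<omega>"
    using assms unfolding subtransversals_def by blast
  moreover have "(S - {x}) \<inter> \<omega> = {}"
    using subtransversals_unique[OF assms(1) w(1) assms(2) w(2)] by blast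
  ultimately show thesis by (rule that)
qed

lemma rank_le_rank_Diff:
  assumes "S \<in> subtransversals (skew_classes Q)" "x \<in> S"
  shows "rank Q (S - {x}) \<le> rank Q S" "rank Q S \<le> rank Q (S - {x}) + 1"
proof -
  obtain \<omega> where w: "\<omega> \<in> skew_classes Q" "x \<in> \<omega>" "(S - {x}) \<inter> \<omega> = {}"
    using subtransversal_skew_class[OF assms] .
  have "S - {x} \<in> subtransversals (skew_classes Q)"
    using subtransversals_mono[OF assms(1)] by blast
  from rank_insert[OF this w(1,3,2)]
  show "rank Q (S - {x}) \<le> rank Q S" "rank Q S \<le> rank Q (S - {x}) + 1"
    using assms(2) by (simp_all add: insert_absorb)
qed

lemma rank_le_card:
  assumes "S \<in> subtransversals (skew_classes Q)"
  shows "rank Q S \<le> card S"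
  using finite_subtransversal[OF assms] assms
proof (induction S rule: finite_induct)
  case empty
  then show ?case by (simp add: rank_empty)
next
  case (insert x S)
  have "S \<in> subtransversals (skew_classes Q)"
    using subtransversals_mono[OF insert.prems] by blast
  then show ?case
    using insert.IH rank_le_rank_Diff(2)[OF insert.prems, of x] insert.hyps by simp
qed

text \<open>By submodularity, an element \<open>x\<close> whose removal lowers the rank of
  \<open>A\<close> also raises the rank of every subset of \<open>A - {x}\<close> to which it is
  added. If all elements other than \<open>e\<close> were of this kind, building \<open>A\<close> up
  from \<open>{e}\<close> would make it independent.\<close>

lemma exists_redundant_element:
  assumes A: "A \<in> subtransversals (skew_classes Q)"
    and e: "e \<in> A" "rank Q {e} = 1"
    and dep: "rank Q A \<noteq> card A"
  shows "\<exists>x\<in>A - {e}. rank Q (A - {x}) = rank Q A"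
proof (rule ccontr)
  assume none: "\<not> ?thesis"
  have sub: "B \<in> subtransversals (skew_classes Q)" if "B \<subseteq> A" for B
    using subtransversals_mono[OF A that] .
  \<comment> \<open>Proved for all \<open>X\<close> so that induction applies; the base case is
    \<open>r({e}) = 1\<close>, and \<open>X = A - {e}\<close> contradicts
    \<open>dep\<close>.\<close>
  have "rank Q (insert e X) = card X + 1" if "X \<subseteq> A - {e}" for X
  proof -
    have "finite X"
      using that finite_subtransversal[OF A] by (meson finite_Diff finite_subset)
    then show ?thesis
      using that
    proof (induction X rule: finite_induct)
      case (insert x X)
      have x: "x \<in> A" "x \<noteq> e" and XA: "insert e X \<subseteq> A - {x}"
        using insert.prems insert.hyps e(1) by auto
      have "insert x (insert e X) \<subseteq> A"
        using x XA by blast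
      note xe = sub[OF this]
      have eqs: "(A - {x}) \<union> insert x (insert e X) = A"
        "(A - {x}) \<inter> insert x (insert e X) = insert e X"
        using x XA by blast+
      have "rank Q (A - {x}) \<noteq> rank Q A"
        using none x by blast
      then have "rank Q (A - {x}) < rank Q A"
        using rank_le_rank_Diff(1)[OF A x(1)] by simp
      \<comment> \<open>The gain of \<open>x\<close> over \<open>insert e X\<close> is at least its
        gain over the larger set \<open>A - {x}\<close>, which is positive.\<close>
      moreover have "rank Q A + rank Q (insert e X)
          \<le> rank Q (A - {x}) + rank Q (insert x (insert e X))"
        using rank_submodular[OF sub[OF Diff_subset] xe, of "{x}"] A unfolding eqs by blast
      moreover have "rank Q (insert x (insert e X)) \<le> card (insert x (insert e X))"
        using rank_le_card[OF xe] .
      moreover have "rank Q (insert e X) = card X + 1"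
        using insert by simp
      moreover have "card (insert x (insert e X)) = card X + 2"
        using insert.hyps insert.prems x(2) by (subst card_insert_disjoint, auto)+
      ultimately show ?case
        using insert.hyps by (simp add: insert_commute)
    qed (use e in auto)
  qed
  from this[of "A - {e}"] have "rank Q A = card A"
    using card_Suc_Diff1[OF finite_subtransversal[OF A] e(1)] e(1) by (simp add: insert_absorb)
  then show False using dep by simp
qed

text \<open>In the minor, \<open>r(X \<union> A)\<close> and \<open>r(A)\<close> both grow by one
  when \<open>x\<close> is replaced by \<open>y\<close>, so their difference is unchanged.\<close>

lemma exchange_redundant_element:
  assumes A: "A \<in> subtransversals (skew_classes Q)"
    and x: "x \<in> A" "rank Q (A - {x}) = rank Q A"
    and w: "\<omega> \<in> skew_classes Q" "x \<in> \<omega>" "y \<in> \<omega>" "y \<noteq> x"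
  defines "A' \<equiv> insert y (A - {x})"
  shows "A' \<in> subtransversals (skew_classes Q)" "rank Q A' = rank Q A + 1"
    "mm_eq (minor Q A) (minor Q A')"
proof -
  define \<Omega> where "\<Omega> = {\<omega> \<in> skew_classes Q. \<omega> \<inter> A = {}}"
  have B: "A - {x} \<in> subtransversals (skew_classes Q)"
    using subtransversals_mono[OF A] by blast
  have d: "(A - {x}) \<inter> \<omega> = {}"
    using subtransversals_unique[OF A w(1) x(1) w(2)] by blast
  show "A' \<in> subtransversals (skew_classes Q)"
    unfolding A'_def using subtransversal_insert[OF B w(1) d w(3)] .
  \<comment> \<open>Since \<open>x\<close> and \<open>y\<close> share the class
    \<open>\<omega>\<close>, the sets \<open>A\<close> and \<open>A'\<close> meet the same skew
    classes, so both minors have the same classes and ground set.\<close>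
  have "\<omega>' \<inter> A = {} \<longleftrightarrow> \<omega>' \<inter> A' = {}" if "\<omega>' \<in> skew_classes Q" for \<omega>'
  proof (cases "\<omega>' = \<omega>")
    case True
    then show ?thesis using x(1) w unfolding A'_def by blast
  next
    case False
    then have "x \<notin> \<omega>'" "y \<notin> \<omega>'"
      using skew_classes_eqI[OF that w(1)] w by blast+
    then show ?thesis unfolding A'_def by blast
  qed
  then have \<Omega>': "\<Omega> = {\<omega> \<in> skew_classes Q. \<omega> \<inter> A' = {}}"
    unfolding \<Omega>_def by blast
  have ranks: "rank Q (X \<union> A) = rank Q (X \<union> (A - {x}))"
    "rank Q (X \<union> A') = rank Q (X \<union> (A - {x})) + 1"
    if X: "X \<in> subtransversals \<Omega>" for X
  proof -
    have XA: "X \<union> A \<in> subtransversals (skew_classes Q)"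
      using subtransversals_minor[OF partition A] X unfolding \<Omega>_def by blast
    then have XB: "X \<union> (A - {x}) \<in> subtransversals (skew_classes Q)"
      by (rule subtransversals_mono) blast
    have "X \<inter> A = {}"
      using X unfolding subtransversals_def \<Omega>_def by blast
    then have eqs: "A \<union> (X \<union> (A - {x})) = X \<union> A" "A \<inter> (X \<union> (A - {x})) = A - {x}"
      "insert x (X \<union> (A - {x})) = X \<union> A" "X \<union> A - {x} = X \<union> (A - {x})"
      using x(1) by auto
    \<comment> \<open>Submodularity for \<open>A\<close> and \<open>X \<union> (A - {x})\<close>:
      the intersection \<open>A - {x}\<close> has the same rank as \<open>A\<close>, and these two
      terms cancel. So \<open>x\<close> stays redundant after adding \<open>X\<close>.\<close>
    have "rank Q (X \<union> A) \<le> rank Q (X \<union> (A - {x}))"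
      using rank_submodular[OF A XB] XA x(2) by (simp add: eqs)
    moreover have "rank Q (X \<union> (A - {x})) \<le> rank Q (X \<union> A)"
      using rank_le_rank_Diff(1)[OF XA, of x] x(1) by (simp add: eqs)
    ultimately show eq: "rank Q (X \<union> A) = rank Q (X \<union> (A - {x}))" by simp
    have dX: "(X \<union> (A - {x})) \<inter> \<omega> = {}"
      using subtransversals_unique[OF XA w(1), of x] x(1) w(2) \<open>X \<inter> A = {}\<close> by blast
    have "insert y (X \<union> (A - {x})) = X \<union> A'"
      unfolding A'_def by blast
    \<comment> \<open>As \<open>x\<close> contributes nothing over
      \<open>X \<union> (A - {x})\<close>, the skew pair axiom forces \<open>y\<close> to contribute
      at least one, and a single element contributes at most one.\<close>
    then show "rank Q (X \<union> A') = rank Q (X \<union> (A - {x})) + 1"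
      using rank_skew_pair[OF XB w(1) dX w(2,3)] rank_insert[OF XB w(1) dX w(3)] w(4) eq
      by (simp add: eqs)
  qed
  have "{} \<in> subtransversals \<Omega>"
    unfolding subtransversals_def by simp
  from ranks(2)[OF this] show rank: "rank Q A' = rank Q A + 1"
    using x(2) by simp
  show "mm_eq (minor Q A) (minor Q A')"
    using ranks rank unfolding mm_eq_def minor_def Let_def \<Omega>'[symmetric] \<Omega>_def[symmetric]
    by simp
qed

end

lemma mm_eq_refl: "mm_eq P P"
  unfolding mm_eq_def by simp

lemma mm_eq_trans: "mm_eq P R \<Longrightarrow> mm_eq R S \<Longrightarrow> mm_eq P S"
  unfolding mm_eq_def by simp

theorem theorem4:
  fixes Q :: "'a mm" and A :: "'a set" and e :: 'a
  assumes "multimatroid Q"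
    and "non_degenerate Q"
    and "A \<in> subtransversals (skew_classes Q)"
    and "e \<in> A"
    and "rank Q {e} = 1"
  shows "\<exists>I. independent Q I \<and> e \<in> I \<and> mm_eq (minor Q A) (minor Q I)"
proof -
  interpret multimatroid Q by fact
  show ?thesis
    using assms(3,4)
  \<comment> \<open>The measure is the nullity of \<open>A\<close>; it is zero exactly for
    independent sets, because the rank never exceeds the cardinality.\<close>
  proof (induction "card A - rank Q A" arbitrary: A rule: less_induct)
    case less
    show ?case
    proof (cases "rank Q A = card A")
      case True
      then show ?thesis
        using less.prems mm_eq_refl unfolding independent_def by blast
    next
      case False
      then obtain x where x: "x \<in> A" "x \<noteq> e" "rank Q (A - {x}) = rank Q A"
        using exists_redundant_element[OF less.prems assms(5)] by blast
      obtain \<omega> where w: "\<omega> \<in> skew_classes Q" "x \<in> \<omega>" "(A - {x}) \<inter> \<omega> = {}"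
        using subtransversal_skew_class[OF less.prems(1) x(1)] .
      \<comment> \<open>Non-degeneracy enters here: it supplies an element to exchange
        \<open>x\<close> for.\<close>
      have "\<omega> \<noteq> {x}"
        using assms(2) w(1) unfolding non_degenerate_def by fastforce
      then obtain y where y: "y \<in> \<omega>" "y \<noteq> x"
        using w(2) by blast
      let ?A' = "insert y (A - {x})"
      note exch = exchange_redundant_element[OF less.prems(1) x(1,3) w(1,2) y]
      have "y \<notin> A - {x}"
        using w(3) y(1) by blast
      then have "card ?A' = card A"
        using card_Suc_Diff1[OF _ x(1)] finite_subtransversal[OF less.prems(1)] by simp
      \<comment> \<open>The bound \<open>rank_le_card\<close> for the new set gives
        \<open>r(A) + 1 \<le> card A\<close>, so the truncated difference really drops.\<close>
      then have "card ?A' - rank Q ?A' < card A - rank Q A"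
        using exch(2) rank_le_card[OF exch(1)] by linarith
      then obtain I where "independent Q I" "e \<in> I" "mm_eq (minor Q ?A') (minor Q I)"
        using less.hyps exch(1) less.prems(2) x(2) by blast
      then show ?thesis
        using mm_eq_trans[OF exch(3)] by blast
    qed
  qed
qed

end
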